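(* Let $\mathcal I$ be an ideal on $\omega$ and let $K\subseteq c_{0,\mathcal I}$ be nonempty. The following conditions are equivalent. (1) $K$ is relatively compact in $c_{0,\mathcal I}$. (2) $K$ is bounded, $a_K\in c_{0,\mathcal I}$, and $P_A(K)$ is relatively compact in $\ell_\infty(A)$ for every $A\in\mathcal I$. (3) There is $b\in c_{0,\mathcal I}^{+}$ such that $|x|\le b$ for each $x\in K$ (i.e. $|x_n|\le b_n$ for all $n$) and, for every $t>0$, $P_{B_t}(K)\subseteq\ell_\infty(B_t)$ is relatively compact, where $B_t=\{n\in\omega: b_n\ge t\}$. (4) $K$ is bounded and, for every $\varepsilon>0$, there are $A\in\mathcal I$ and a finite partition $A=A_1\,\dot\cup\cdots\dot\cup\, A_m$ such that $$\sup_{x\in K}\sup_{n\notin A}|x_n|<\varepsilon\qquad\text{and}\qquad \sup_{x\in K}\sup_{n,k\in A_j}|x_n-x_k|<\varepsilon\quad(j=1,\dots,m).$$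
   Context: An ideal on $\omega$ is a collection of subsets of $\omega$ containing $\emptyset$, closed under subsets and finite unions; every ideal is assumed to contain all finite sets. $c_{0,\mathcal I}$ is the closed subspace of $\ell_\infty$ (sup norm) of all bounded scalar sequences $(x_n)$ with $\{n:|x_n|\ge\varepsilon\}\in\mathcal I$ for every $\varepsilon>0$; $c_{0,\mathcal I}^+$ is the set of its elements with all coordinates real and $\ge0$. For bounded $K$, $a_K(n)=\sup_{x\in K}|x_n|$, $n\in\omega$. For $A\in\mathcal I$ and bounded $K$, $P_A(K)=\{x|_A\in\ell_\infty(A):x\in K\}$. Suprema of empty sets of nonnegative reals are $0$. *)

theory Defs
  imports "HOL-Analysis.Analysis"
begin

text \<open>Ideals are not required to be proper.\<close>

definition omega_ideal :: "nat set set \<Rightarrow> bool" where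
  "omega_ideal I \<longleftrightarrow>
     {} \<in> I \<and>
     (\<forall>A B. A \<in> I \<longrightarrow> B \<subseteq> A \<longrightarrow> B \<in> I) \<and>
     (\<forall>A B. A \<in> I \<longrightarrow> B \<in> I \<longrightarrow> A \<union> B \<in> I) \<and>
     (\<forall>A. finite A \<longrightarrow> A \<in> I)"

text \<open>
  Real supremum of a set of nonnegative reals, with the convention that the supremum of the
  empty set is 0. As for \<^term>\<open>Sup\<close> on the reals, the value is meaningful only for
  sets that are bounded above.
\<close>

definition nnsup :: "real set \<Rightarrow> real" where
  "nnsup S = (if S = {} then 0 else Sup S)"

text \<open>
  The scalars range over a type of class \<^class>\<open>real_normed_field\<close> and
  \<^class>\<open>heine_borel\<close>, which covers both \<^typ>\<open>real\<close> and \<^typ>\<open>complex\<close>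
  (and, up to isometric isomorphism, nothing else).

  \<open>linf A\<close> is the space of bounded scalar families indexed by \<open>A\<close> with the
  metric of the supremum norm. A family indexed by \<open>A\<close> is a function on \<open>nat\<close> that is
  \<^term>\<open>undefined\<close> outside \<open>A\<close>; for \<open>A = UNIV\<close> these are all the sequences.
\<close>

definition linf :: "nat set \<Rightarrow> (nat \<Rightarrow> 'a::{real_normed_field,heine_borel}) metric" where
  "linf A = funspace A euclidean_metric"

definition c0_ideal :: "nat set set \<Rightarrow> (nat \<Rightarrow> 'a::{real_normed_field,heine_borel}) metric" where
  "c0_ideal I = submetric (linf UNIV) {x. \<forall>\<epsilon>>0. {n. norm (x n) \<ge> \<epsilon>} \<in> I}"

text \<open>
  Sequences with real coordinates, such as the elements of the positive cone and the
  sequence \<open>a_seq K\<close>, are represented as real sequences for every choice of the scalars;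
  membership in \<open>c0_ideal I\<close> depends only on the moduli of the coordinates.
\<close>

definition c0_ideal_pos :: "nat set set \<Rightarrow> (nat \<Rightarrow> real) set" where
  "c0_ideal_pos I = {b \<in> mspace (c0_ideal I). \<forall>n. 0 \<le> b n}"

definition a_seq :: "(nat \<Rightarrow> 'a::{real_normed_field,heine_borel}) set \<Rightarrow> nat \<Rightarrow> real" where
  "a_seq K n = nnsup {norm (x n) | x. x \<in> K}"

definition proj_set :: "nat set \<Rightarrow> (nat \<Rightarrow> 'a) set \<Rightarrow> (nat \<Rightarrow> 'a) set" where
  "proj_set A K = (\<lambda>x. restrict x A) ` K"

definition bounded_in :: "'a metric \<Rightarrow> 'a set \<Rightarrow> bool" where
  "bounded_in m S \<longleftrightarrow> Metric_space.mbounded (mspace m) (mdist m) S"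

definition relatively_compact_in :: "'a metric \<Rightarrow> 'a set \<Rightarrow> bool" where
  "relatively_compact_in m S \<longleftrightarrow>
     S \<subseteq> mspace m \<and> compactin (mtopology_of m) (mtopology_of m closure_of S)"

end

theory Submission
  imports Defs
begin

text \<open>
  Both \<open>linf A\<close> and \<open>c0_ideal I\<close> are complete, so relative compactness is the
  existence of finite nets for the supremum norm. Given a finite net \<open>F\<close> over \<open>A\<close>, the
  map sending \<open>n \<in> A\<close> to a rounding of the vector of all \<open>y n\<close>, \<open>y \<in> F\<close>,
  has finite range, and its fibres form a partition of \<open>A\<close> on which all members of \<open>K\<close>
  oscillate little. Conversely, given a partition, rounding the values of \<open>x \<in> K\<close> at one
  point of each cell takes finitely many values and determines \<open>x\<close> up to a small error.
  A net over all indices also makes \<open>a_seq K\<close> small wherever the finitely many members of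
  the net are, and \<open>a_seq K\<close> is then a possible choice of the dominating sequence \<open>b\<close>.
\<close>

section \<open>Nested suprema with the empty-set convention\<close>

lemma nnsup_le:
  assumes "\<And>s. s \<in> S \<Longrightarrow> s \<le> B" "0 \<le> B"
  shows "nnsup S \<le> B"
  using assms by (auto simp: nnsup_def intro: cSup_least)

lemma le_nnsup:
  assumes "s \<in> S" "\<And>s. s \<in> S \<Longrightarrow> s \<le> B"
  shows "s \<le> nnsup S"
  using assms by (auto simp: nnsup_def intro!: cSup_upper bdd_aboveI)

text \<open>Turns pointwise bounds into the nested suprema of condition (4).
  \<open>0 \<le> B\<close> covers the default value 0, taken when \<open>K\<close> or some
  \<open>S x\<close> is empty.\<close>

lemma nnsup_nnsup_le:
  assumes "\<And>x s. \<lbrakk>x \<in> K; s \<in> S x\<rbrakk> \<Longrightarrow> s \<le> B" "0 \<le> B"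
  shows "nnsup {nnsup (S x) | x. x \<in> K} \<le> B"
proof (rule nnsup_le)
  fix s assume "s \<in> {nnsup (S x) | x. x \<in> K}"
  then obtain x where "x \<in> K" "s = nnsup (S x)" by blast
  with assms show "s \<le> B" by (simp add: nnsup_le)
qed (rule assms(2))

text \<open>Recovers pointwise bounds from condition (4). The uniform bound \<open>B\<close> makes
  \<open>Sup\<close> meaningful at both levels: it bounds each \<open>S x\<close> and, with
  \<open>0 \<le> B\<close>, also each inner supremum, empty ones included.\<close>

lemma le_nnsup_nnsup:
  assumes "x \<in> K" "s \<in> S x" "\<And>x s. \<lbrakk>x \<in> K; s \<in> S x\<rbrakk> \<Longrightarrow> s \<le> B" "0 \<le> B"
  shows "s \<le> nnsup {nnsup (S x) | x. x \<in> K}"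
proof -
  have "s \<le> nnsup (S x)"
    using assms(2) assms(3)[OF assms(1)] by (rule le_nnsup)
  also have "\<dots> \<le> nnsup {nnsup (S x) | x. x \<in> K}"
  proof (rule le_nnsup)
    fix s assume "s \<in> {nnsup (S x) | x. x \<in> K}"
    then obtain x where "x \<in> K" "s = nnsup (S x)" by blast
    with assms(3,4) show "s \<le> B" by (simp add: nnsup_le)
  qed (use assms(1) in blast)
  finally show ?thesis .
qed

section \<open>The sup metric and completeness of the two spaces\<close>

lemma mspace_linf: "mspace (linf A) = {x. x \<in> extensional A \<and> bounded (x ` A)}"
  by (auto simp: linf_def Met_TC.fspace_def)

lemma mdist_linf_le_iff:
  assumes "x \<in> mspace (linf A)" "y \<in> mspace (linf A)" "0 \<le> a"
  shows "mdist (linf A) x y \<le> a \<longleftrightarrow> (\<forall>n\<in>A. norm (x n - y n) \<le> a)"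
\<comment> \<open>Over the empty index set the distance is 0 by definition rather than a supremum,
  so this case rests on \<open>0 \<le> a\<close>.\<close>
proof (cases "A = {}")
  case True
  with assms show ?thesis
    by (simp add: linf_def Met_TC.fdist_def)
next
  case False
  with assms show ?thesis
    by (simp add: linf_def funspace_mdist_le Met_TC.funspace_mdist_le dist_norm)
qed

lemma mcomplete_linf:
  "Metric_space.mcomplete (mspace (linf A :: (nat \<Rightarrow> 'a::{real_normed_field,heine_borel}) metric))
     (mdist (linf A))"
proof -
  have "mcomplete_of (funspace A (euclidean_metric :: 'a metric))"
    using Met_TC.mcomplete_funspace[where 'a='a and S=A] complete_UNIV
    by (simp add: euclidean_metric_def Met_TC.Self_def)
  then show ?thesis
    by (simp add: mcomplete_of_def linf_def)
qed

lemma mspace_c0_ideal: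
  "mspace (c0_ideal I) = {x. bounded (range x) \<and> (\<forall>\<epsilon>>0. {n. \<epsilon> \<le> norm (x n)} \<in> I)}"
  by (auto simp: c0_ideal_def mspace_linf)

lemma mdist_c0_ideal [simp]: "mdist (c0_ideal I) = mdist (linf UNIV)"
  by (simp add: c0_ideal_def)

text \<open>A sequentially closed subset of a complete space is complete. For closedness, a member
  \<open>s k\<close> within \<open>\<epsilon>/2\<close> of the limit \<open>l\<close> has modulus at
  least \<open>\<epsilon>/2\<close> wherever \<open>l\<close> has modulus at least
  \<open>\<epsilon>\<close>, so the large set of \<open>l\<close> lies in a set of the
  ideal.\<close>

lemma mcomplete_c0_ideal:
  assumes I: "omega_ideal I"
  shows "Metric_space.mcomplete (mspace (c0_ideal I :: (nat \<Rightarrow> 'a::{real_normed_field,heine_borel}) metric))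
     (mdist (c0_ideal I))"
proof -
  let ?L = "linf UNIV :: (nat \<Rightarrow> 'a) metric"
  let ?C = "mspace (c0_ideal I :: (nat \<Rightarrow> 'a) metric)"
  interpret S: Submetric "mspace ?L" "mdist ?L" ?C
    by (simp add: Submetric.intro Submetric_axioms_def c0_ideal_def)
  have "S.sub.mcomplete"
  proof (rule S.sequentially_closedin_mcomplete_imp_mcomplete[OF mcomplete_linf])
    fix s l assume s: "range s \<subseteq> ?C \<and> limitin S.mtopology s l sequentially"
    then have l: "l \<in> mspace ?L"
      using S.limitin_mspace by blast
    have "{n. \<epsilon> \<le> norm (l n)} \<in> I" if "\<epsilon> > 0" for \<epsilon>
    proof -
      have "\<epsilon>/2 > 0" using that by simp
      with s obtain k where k: "s k \<in> mspace ?L" "mdist ?L (s k) l < \<epsilon>/2"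
        unfolding S.limit_metric_sequentially by (meson order_refl)
      then have "norm (s k n - l n) \<le> \<epsilon>/2" for n
        using mdist_linf_le_iff[OF k(1) l, of "\<epsilon>/2"] that by auto
      moreover have "norm (l n) \<le> norm (s k n) + norm (s k n - l n)" for n
        by (metis norm_minus_commute norm_triangle_sub)
      ultimately have "norm (l n) \<le> norm (s k n) + \<epsilon>/2" for n
        by (meson add_left_mono order_trans)
      then have "{n. \<epsilon> \<le> norm (l n)} \<subseteq> {n. \<epsilon>/2 \<le> norm (s k n)}"
        by (smt (verit) Collect_mono field_sum_of_halves)
      moreover have "s k \<in> ?C"
        using s by blast
      then have "{n. \<epsilon>/2 \<le> norm (s k n)} \<in> I"
        using \<open>\<epsilon>/2 > 0\<close> unfolding mspace_c0_ideal by blast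
      ultimately show ?thesis
        using I unfolding omega_ideal_def by blast
    qed
    with l show "l \<in> ?C"
      by (simp add: mspace_linf mspace_c0_ideal)
  qed
  then show ?thesis
    by simp
qed

section \<open>Relative compactness as existence of finite nets\<close>

lemma relatively_compact_in_iff_mtotally_bounded:
  assumes "Metric_space.mcomplete (mspace m) (mdist m)"
  shows "relatively_compact_in m S \<longleftrightarrow> Metric_space.mtotally_bounded (mspace m) (mdist m) S"
  using Metric_space.mtotally_bounded_eq_compact_closure_of[OF Metric_space_mspace_mdist assms]
  by (simp add: relatively_compact_in_def mtopology_of_def)

text \<open>Non-strict distances are preferred to open balls because
  \<open>mdist_linf_le_iff\<close> makes them pointwise. Halving the radius restores
  strictness.\<close>

lemma mtotally_bounded_le_iff:
  assumes "Metric_space M d" "S \<subseteq> M"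
  shows "Metric_space.mtotally_bounded M d S \<longleftrightarrow>
    (\<forall>\<epsilon>>0. \<exists>F. finite F \<and> F \<subseteq> S \<and> (\<forall>x\<in>S. \<exists>y\<in>F. d x y \<le> \<epsilon>))" (is "?L \<longleftrightarrow> ?R")
proof -
  interpret Metric_space M d by fact
  show ?thesis
  proof
    assume ?L
    then show ?R
      unfolding mtotally_bounded_def
      by (smt (verit) UN_E commute in_mball subset_iff)
  next
    assume R: ?R
    show ?L
      unfolding mtotally_bounded_def
    proof (intro allI impI)
      fix \<epsilon> :: real assume "\<epsilon> > 0"
      then have "\<epsilon>/2 > 0" by simp
      with R obtain F where F: "finite F" "F \<subseteq> S" "\<forall>x\<in>S. \<exists>y\<in>F. d x y \<le> \<epsilon>/2"
        by meson
      have "S \<subseteq> (\<Union>x\<in>F. mball x \<epsilon>)"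
      proof
        fix x assume "x \<in> S"
        with F obtain y where y: "y \<in> F" "d x y \<le> \<epsilon>/2" by blast
        then have "x \<in> M" "y \<in> M" "d y x < \<epsilon>"
          using \<open>x \<in> S\<close> \<open>\<epsilon> > 0\<close> assms(2) F(2) by (auto simp: commute[of y x])
        with y(1) show "x \<in> (\<Union>x\<in>F. mball x \<epsilon>)"
          by auto
      qed
      with F show "\<exists>K. finite K \<and> K \<subseteq> S \<and> S \<subseteq> (\<Union>x\<in>K. mball x \<epsilon>)"
        by blast
    qed
  qed
qed

text \<open>The pointwise description of the distance is available only for points of
  \<open>S\<close> and positive radii, so the rewriting under the quantifiers has to carry these
  side conditions.\<close>

lemma finite_nets_cong:
  assumes "\<And>x y \<epsilon>. \<lbrakk>x \<in> S; y \<in> S; \<epsilon> > 0\<rbrakk> \<Longrightarrow> P x y \<epsilon> \<longleftrightarrow> Q x y \<epsilon>"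
  shows "(\<forall>\<epsilon>>0::real. \<exists>F. finite F \<and> F \<subseteq> S \<and> (\<forall>x\<in>S. \<exists>y\<in>F. P x y \<epsilon>)) \<longleftrightarrow>
    (\<forall>\<epsilon>>0. \<exists>F. finite F \<and> F \<subseteq> S \<and> (\<forall>x\<in>S. \<exists>y\<in>F. Q x y \<epsilon>))"
  by (intro iff_allI imp_cong ex_cong1 conj_cong ball_cong bex_cong refl) (use assms in blast)

text \<open>Total boundedness for the sup seminorm over \<open>A\<close>. Members of
  \<open>K\<close> are not restricted to \<open>A\<close>, and centres lie in \<open>K\<close>, so
  one notion serves \<open>linf A\<close> and \<open>c0_ideal I\<close> alike and is monotone in
  \<open>A\<close>.\<close>

definition finite_uniform_nets :: "'i set \<Rightarrow> ('i \<Rightarrow> 'a::real_normed_vector) set \<Rightarrow> bool" where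
  "finite_uniform_nets A K \<longleftrightarrow>
     (\<forall>\<epsilon>>0. \<exists>F. finite F \<and> F \<subseteq> K \<and> (\<forall>x\<in>K. \<exists>y\<in>F. \<forall>n\<in>A. norm (x n - y n) \<le> \<epsilon>))"

lemma relatively_compact_in_linf_iff:
  assumes K: "\<And>x. x \<in> K \<Longrightarrow> bounded (x ` A)"
  shows "relatively_compact_in (linf A) (proj_set A K) \<longleftrightarrow> finite_uniform_nets A K"
proof -
  have sub: "proj_set A K \<subseteq> mspace (linf A)"
    using K by (auto simp: proj_set_def mspace_linf)
  have le: "mdist (linf A) (restrict x A) (restrict y A) \<le> \<epsilon> \<longleftrightarrow> (\<forall>n\<in>A. norm (x n - y n) \<le> \<epsilon>)"
    if "x \<in> K" "y \<in> K" "\<epsilon> > 0" for x y \<epsilon>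
    using mdist_linf_le_iff[of "restrict x A" A "restrict y A" \<epsilon>] sub that
    by (auto simp: proj_set_def)
  have "relatively_compact_in (linf A) (proj_set A K) \<longleftrightarrow>
    (\<forall>\<epsilon>>0. \<exists>F. finite F \<and> F \<subseteq> proj_set A K \<and> (\<forall>x\<in>proj_set A K. \<exists>y\<in>F. mdist (linf A) x y \<le> \<epsilon>))"
    by (simp add: relatively_compact_in_iff_mtotally_bounded mcomplete_linf mtotally_bounded_le_iff sub)
  also have "\<dots> \<longleftrightarrow> (\<forall>\<epsilon>>0. \<exists>F. finite F \<and> F \<subseteq> K \<and>
      (\<forall>x\<in>K. \<exists>y\<in>F. mdist (linf A) (restrict x A) (restrict y A) \<le> \<epsilon>))"
    \<comment> \<open>Every finite subset of the image \<open>proj_set A K\<close> is the image of a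
      finite subset of \<open>K\<close>, so centres can be lifted to \<open>K\<close>.\<close>
    unfolding proj_set_def ex_finite_subset_image by simp
  also have "\<dots> \<longleftrightarrow> finite_uniform_nets A K"
    unfolding finite_uniform_nets_def using le by (rule finite_nets_cong)
  finally show ?thesis .
qed

lemma relatively_compact_in_c0_ideal_iff:
  assumes "omega_ideal I" and sub: "K \<subseteq> mspace (c0_ideal I)"
  shows "relatively_compact_in (c0_ideal I) K \<longleftrightarrow> finite_uniform_nets UNIV K"
proof -
  have "x \<in> mspace (linf UNIV)" if "x \<in> K" for x
    using sub that by (auto simp: mspace_linf mspace_c0_ideal)
  then have le: "mdist (linf UNIV) x y \<le> \<epsilon> \<longleftrightarrow> (\<forall>n\<in>UNIV. norm (x n - y n) \<le> \<epsilon>)"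
    if "x \<in> K" "y \<in> K" "\<epsilon> > 0" for x y \<epsilon>
    using mdist_linf_le_iff[of x UNIV y \<epsilon>] that by auto
  have "relatively_compact_in (c0_ideal I) K \<longleftrightarrow>
    (\<forall>\<epsilon>>0. \<exists>F. finite F \<and> F \<subseteq> K \<and> (\<forall>x\<in>K. \<exists>y\<in>F. mdist (c0_ideal I) x y \<le> \<epsilon>))"
    unfolding relatively_compact_in_iff_mtotally_bounded[OF mcomplete_c0_ideal[OF assms(1)]]
    by (rule mtotally_bounded_le_iff[OF Metric_space_mspace_mdist sub])
  also have "\<dots> \<longleftrightarrow> finite_uniform_nets UNIV K"
    unfolding finite_uniform_nets_def mdist_c0_ideal using le by (rule finite_nets_cong)
  finally show ?thesis .
qed

section \<open>Metric boundedness as a uniform bound on coordinates\<close>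

lemma bounded_in_linf_iff:
  assumes "K \<subseteq> mspace (linf UNIV)"
  shows "bounded_in (linf UNIV) K \<longleftrightarrow> (\<exists>B. \<forall>x\<in>K. \<forall>n. norm (x n) \<le> B)" (is "?L \<longleftrightarrow> ?R")
proof -
  interpret Metric_space "mspace (linf UNIV :: (nat \<Rightarrow> 'a) metric)" "mdist (linf UNIV)"
    by simp
  show ?thesis
  proof
    assume ?L
    show ?R
    \<comment> \<open>A ball containing the empty set may have a centre outside the space or a
      negative radius; a member of \<open>K\<close> excludes both.\<close>
    proof (cases "K = {}")
      case True
      then show ?thesis by simp
    next
      case False
      obtain y B where yB: "K \<subseteq> mcball y B"
        using \<open>?L\<close> unfolding bounded_in_def mbounded_def by blast
      obtain x0 where "x0 \<in> mcball y B"
        using False yB by blast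
      then have y: "y \<in> mspace (linf UNIV)" and "0 \<le> B"
        by (simp, meson in_mcball nonneg order_trans)
      obtain C where C: "\<And>n. norm (y n) \<le> C"
        using y by (auto simp: mspace_linf bounded_iff)
      have "norm (x n) \<le> B + C" if "x \<in> K" for x n
      proof -
        have "norm (y n - x n) \<le> B"
          using that yB assms \<open>0 \<le> B\<close> mdist_linf_le_iff[of y UNIV x B] by auto
        with C[of n] show ?thesis
          using norm_triangle_sub[of "x n" "y n"] by (simp add: norm_minus_commute)
      qed
      then show ?R by blast
    qed
  next
    assume ?R
    then obtain B where B: "\<forall>x\<in>K. \<forall>n. norm (x n) \<le> B" by blast
    have z: "(\<lambda>_. 0) \<in> mspace (linf UNIV :: (nat \<Rightarrow> 'a) metric)"
      by (auto simp: mspace_linf)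
    \<comment> \<open>If \<open>K\<close> is empty, \<open>B\<close> may be negative, whereas
      \<open>mdist_linf_le_iff\<close> asks for a nonnegative radius.\<close>
    have "K \<subseteq> mcball (\<lambda>_. 0) (max 0 B)"
    proof
      fix x assume "x \<in> K"
      with B z assms show "x \<in> mcball (\<lambda>_. 0) (max 0 B)"
        using mdist_linf_le_iff[OF z, of x "max 0 B"] by (auto simp: le_max_iff_disj)
    qed
    then show ?L
      unfolding bounded_in_def mbounded_def by blast
  qed
qed

section \<open>Finite nets versus finite partitions\<close>

text \<open>Each coordinate has bounded range, hence a finite \<open>\<delta>/2\<close>-net by the
  Heine-Borel property; \<open>g x\<close> records a nearby centre for every \<open>j\<close>. It is
  applied in two dual ways: to code indices by the values of finitely many sequences, and to code
  sequences by their values at finitely many indices.\<close>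

lemma finite_coding:
  fixes f :: "'b \<Rightarrow> 'j \<Rightarrow> 'a::{real_normed_vector,heine_borel}"
  assumes "finite J" and bdd: "\<And>j. j \<in> J \<Longrightarrow> bounded ((\<lambda>x. f x j) ` X)" and "\<delta> > 0"
  obtains g :: "'b \<Rightarrow> 'j \<Rightarrow> 'a" where "finite (g ` X)"
    "\<And>x y j. \<lbrakk>x \<in> X; y \<in> X; g x = g y; j \<in> J\<rbrakk> \<Longrightarrow> norm (f x j - f y j) \<le> \<delta>"
proof -
  have "\<exists>C. finite C \<and> (\<forall>x\<in>X. \<exists>c\<in>C. dist (f x j) c < \<delta>/2)" if "j \<in> J" for j
  proof -
    have "compact (closure ((\<lambda>x. f x j) ` X))"
      using bdd[OF that] by simp
    then obtain C where C: "finite C" "closure ((\<lambda>x. f x j) ` X) \<subseteq> (\<Union>c\<in>C. ball c (\<delta>/2))"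
      using \<open>\<delta> > 0\<close> unfolding compact_eq_totally_bounded by (meson half_gt_zero)
    have "\<exists>c\<in>C. dist (f x j) c < \<delta>/2" if "x \<in> X" for x
    proof -
      have "f x j \<in> (\<Union>c\<in>C. ball c (\<delta>/2))"
        using C(2) closure_subset that by fast
      then show ?thesis by (auto simp: dist_commute)
    qed
    with C(1) show ?thesis by blast
  qed
  then obtain C where C: "\<And>j. j \<in> J \<Longrightarrow> finite (C j)"
    "\<And>j x. \<lbrakk>j \<in> J; x \<in> X\<rbrakk> \<Longrightarrow> \<exists>c\<in>C j. dist (f x j) c < \<delta>/2"
    by metis
  then obtain c where c: "\<And>j x. \<lbrakk>j \<in> J; x \<in> X\<rbrakk> \<Longrightarrow> c j x \<in> C j \<and> dist (f x j) (c j x) < \<delta>/2"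
    by metis
  \<comment> \<open>Restricting to \<open>J\<close> puts all codes into the finite product
    \<open>PiE J C\<close>.\<close>
  define g where "g x = restrict (\<lambda>j. c j x) J" for x
  show thesis
  proof
    have "g ` X \<subseteq> PiE J C"
      using c by (auto simp: g_def)
    then show "finite (g ` X)"
      using C(1) \<open>finite J\<close> finite_PiE finite_subset by metis
    show "norm (f x j - f y j) \<le> \<delta>" if "x \<in> X" "y \<in> X" "g x = g y" "j \<in> J" for x y j
    proof -
      have "c j x = c j y"
        using that(3,4) unfolding g_def by (metis restrict_apply')
      then show ?thesis
        using c[OF that(4,1)] c[OF that(4,2)] dist_triangle_half_l[of "f x j" "c j x" \<delta> "f y j"]
        by (simp add: dist_norm)
    qed
  qed
qed

text \<open>The cells are the fibres of the code of \<open>n\<close> by the values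
  \<open>y n\<close>, \<open>y \<in> F\<close>. Within a fibre the oscillation of \<open>x\<close>
  costs \<open>\<epsilon>/3\<close> for \<open>y\<close> and twice \<open>\<epsilon>/3\<close> for
  replacing \<open>x\<close> by a nearby \<open>y\<close>.\<close>

lemma finite_uniform_nets_partition:
  fixes K :: "(nat \<Rightarrow> 'a::{real_normed_vector,heine_borel}) set"
  assumes nets: "finite_uniform_nets A K" and bdd: "\<And>x. x \<in> K \<Longrightarrow> bounded (x ` A)" and "\<epsilon> > 0"
  obtains m and P :: "nat \<Rightarrow> nat set" where "A = (\<Union>j\<in>{1..m}. P j)" "disjoint_family_on P {1..m}"
    "\<And>j x n k. \<lbrakk>j \<in> {1..m}; x \<in> K; n \<in> P j; k \<in> P j\<rbrakk> \<Longrightarrow> norm (x n - x k) \<le> \<epsilon>"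
proof -
  have "\<epsilon>/3 > 0" using \<open>\<epsilon> > 0\<close> by simp
  with nets obtain F where F: "finite F" "F \<subseteq> K"
    "\<And>x. x \<in> K \<Longrightarrow> \<exists>y\<in>F. \<forall>n\<in>A. norm (x n - y n) \<le> \<epsilon>/3"
    unfolding finite_uniform_nets_def by meson
  obtain g :: "nat \<Rightarrow> (nat \<Rightarrow> 'a) \<Rightarrow> 'a" where g: "finite (g ` A)"
    "\<And>n k y. \<lbrakk>n \<in> A; k \<in> A; g n = g k; y \<in> F\<rbrakk> \<Longrightarrow> norm (y n - y k) \<le> \<epsilon>/3"
    using finite_coding[of F "\<lambda>n y. y n" A "\<epsilon>/3"] F(1,2) bdd \<open>\<epsilon>/3 > 0\<close> by blast
  have osc: "norm (x n - x k) \<le> \<epsilon>" if "x \<in> K" "n \<in> A" "k \<in> A" "g n = g k" for x n k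
  proof -
    obtain y where y: "y \<in> F" "\<forall>n\<in>A. norm (x n - y n) \<le> \<epsilon>/3"
      using F(3) \<open>x \<in> K\<close> by blast
    have "x n - x k = (x n - y n) + (y n - y k) - (x k - y k)"
      by simp
    then have "norm (x n - x k) \<le> norm (x n - y n) + norm (y n - y k) + norm (x k - y k)"
      by (metis norm_triangle_ineq4 order_trans norm_triangle_ineq add_right_mono)
    moreover have "norm (x n - y n) \<le> \<epsilon>/3" "norm (x k - y k) \<le> \<epsilon>/3" "norm (y n - y k) \<le> \<epsilon>/3"
      using y g(2) that by auto
    ultimately show ?thesis by linarith
  qed
  \<comment> \<open>Numbering the codes from 1 gives the index set \<open>{1..m}\<close>;
    injectivity of \<open>h\<close> makes the fibres disjoint.\<close>
  obtain h where h: "bij_betw h {1..card (g ` A)} (g ` A)"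
    using ex_bij_betw_nat_finite_1[OF g(1)] by blast
  define P where "P j = {n\<in>A. g n = h j}" for j
  show thesis
  proof
    have "\<exists>j\<in>{1..card (g ` A)}. g n = h j" if "n \<in> A" for n
      using bij_betw_imp_surj_on[OF h] that by (metis imageE imageI)
    then show "A = (\<Union>j\<in>{1..card (g ` A)}. P j)"
      unfolding P_def by blast
    show "disjoint_family_on P {1..card (g ` A)}"
      using bij_betw_imp_inj_on[OF h] unfolding P_def disjoint_family_on_def inj_on_def by fastforce
    show "norm (x n - x k) \<le> \<epsilon>" if "x \<in> K" "n \<in> P j" "k \<in> P j" for j x n k
      using osc[of x n k] that by (simp add: P_def)
  qed
qed

text \<open>Sequences with equal codes at the cell representatives are
  \<open>\<epsilon>\<close>-close: inside a cell through the representative, with three errors of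
  \<open>\<epsilon>/3\<close>, and outside all cells because both are small there.\<close>

lemma finite_uniform_nets_UNIV_if_partitions:
  fixes K :: "(nat \<Rightarrow> 'a::{real_normed_vector,heine_borel}) set"
  assumes bdd: "\<And>x n. x \<in> K \<Longrightarrow> norm (x n) \<le> B"
    and part: "\<And>\<epsilon>. \<epsilon> > 0 \<Longrightarrow> \<exists>m. \<exists>P :: nat \<Rightarrow> nat set.
      (\<forall>x\<in>K. (\<forall>n. n \<notin> (\<Union>j\<in>{1..m}. P j) \<longrightarrow> norm (x n) \<le> \<epsilon>) \<and>
        (\<forall>j\<in>{1..m}. \<forall>n\<in>P j. \<forall>k\<in>P j. norm (x n - x k) \<le> \<epsilon>))"
  shows "finite_uniform_nets UNIV K"
  unfolding finite_uniform_nets_def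
proof (intro allI impI)
  fix \<epsilon> :: real assume "\<epsilon> > 0"
  then have e: "\<epsilon>/3 > 0" by simp
  from part[OF this] obtain m and P :: "nat \<Rightarrow> nat set" where
    out: "\<And>x n. \<lbrakk>x \<in> K; n \<notin> (\<Union>j\<in>{1..m}. P j)\<rbrakk> \<Longrightarrow> norm (x n) \<le> \<epsilon>/3" and
    osc: "\<And>x j n k. \<lbrakk>x \<in> K; j \<in> {1..m}; n \<in> P j; k \<in> P j\<rbrakk> \<Longrightarrow> norm (x n - x k) \<le> \<epsilon>/3"
    by meson
  \<comment> \<open>For an empty cell \<open>r j\<close> is an arbitrary index. It is still coded,
    but \<open>close\<close> appeals only to cells that contain some \<open>n\<close>.\<close>
  define r where "r j = (SOME n. n \<in> P j)" for j
  have r: "r j \<in> P j" if "n \<in> P j" for n j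
    unfolding r_def using that by (rule someI)
  have "bounded ((\<lambda>x. x (r j)) ` K)" for j
    using bdd by (auto simp: bounded_iff)
  then obtain g :: "(nat \<Rightarrow> 'a) \<Rightarrow> nat \<Rightarrow> 'a" where g: "finite (g ` K)"
    "\<And>x y j. \<lbrakk>x \<in> K; y \<in> K; g x = g y; j \<in> {1..m}\<rbrakk> \<Longrightarrow> norm (x (r j) - y (r j)) \<le> \<epsilon>/3"
    using finite_coding[of "{1..m}" "\<lambda>x j. x (r j)" K "\<epsilon>/3"] e by blast
  have close: "norm (x n - y n) \<le> \<epsilon>" if "x \<in> K" "y \<in> K" "g x = g y" for x y n
  proof (cases "n \<in> (\<Union>j\<in>{1..m}. P j)")
    case True
    then obtain j where j: "j \<in> {1..m}" "n \<in> P j" by blast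
    have "x n - y n = (x n - x (r j)) + (x (r j) - y (r j)) - (y n - y (r j))"
      by simp
    then have "norm (x n - y n) \<le> norm (x n - x (r j)) + norm (x (r j) - y (r j)) + norm (y n - y (r j))"
      by (metis norm_triangle_ineq4 order_trans norm_triangle_ineq add_right_mono)
    moreover have "norm (x n - x (r j)) \<le> \<epsilon>/3" "norm (y n - y (r j)) \<le> \<epsilon>/3"
      "norm (x (r j) - y (r j)) \<le> \<epsilon>/3"
      using osc g(2) that j r by blast+
    ultimately show ?thesis by linarith
  next
    case False
    with out that have "norm (x n) \<le> \<epsilon>/3" "norm (y n) \<le> \<epsilon>/3" by blast+
    then show ?thesis
      using norm_triangle_ineq4[of "x n" "y n"] e by linarith
  qed
  \<comment> \<open>Finitely many members of \<open>K\<close> realise all codes; they form the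
    net.\<close>
  obtain F where "F \<subseteq> K" "finite F" "g ` K = g ` F"
    using finite_subset_image[OF g(1) subset_refl] by blast
  moreover have "\<exists>y\<in>F. \<forall>n\<in>UNIV. norm (x n - y n) \<le> \<epsilon>" if "x \<in> K" for x
  proof -
    have "g x \<in> g ` F"
      using \<open>g ` K = g ` F\<close> that by blast
    then obtain y where "y \<in> F" "g x = g y" by blast
    moreover from this have "norm (x n - y n) \<le> \<epsilon>" for n
      using \<open>x \<in> K\<close> \<open>F \<subseteq> K\<close> by (intro close) auto
    ultimately show ?thesis by blast
  qed
  ultimately show "\<exists>F. finite F \<and> F \<subseteq> K \<and> (\<forall>x\<in>K. \<exists>y\<in>F. \<forall>n\<in>UNIV. norm (x n - y n) \<le> \<epsilon>)"
    by blast
qed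

section \<open>Consequences of nets, and the sequence \<open>a_seq K\<close>\<close>

lemma finite_uniform_nets_subset:
  assumes "finite_uniform_nets A K" "B \<subseteq> A"
  shows "finite_uniform_nets B K"
  using assms unfolding finite_uniform_nets_def by (meson subsetD)

text \<open>A net of radius 1 consists of finitely many bounded sequences, and every member of
  \<open>K\<close> exceeds their common bound by at most 1.\<close>

lemma finite_uniform_nets_imp_bounded:
  assumes nets: "finite_uniform_nets UNIV K" and bdd: "\<And>x. x \<in> K \<Longrightarrow> bounded (range x)"
  shows "\<exists>B. \<forall>x\<in>K. \<forall>n. norm (x n) \<le> B"
proof -
  obtain F where F: "finite F" "F \<subseteq> K" "\<And>x. x \<in> K \<Longrightarrow> \<exists>y\<in>F. \<forall>n. norm (x n - y n) \<le> 1"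
    using nets unfolding finite_uniform_nets_def by (metis UNIV_I zero_less_one)
  have "bounded (\<Union>y\<in>F. range y)"
    using F(1,2) bdd by (auto intro: bounded_UN)
  then obtain B where B: "\<And>y n. y \<in> F \<Longrightarrow> norm (y n) \<le> B"
    unfolding bounded_iff by blast
  have "norm (x n) \<le> B + 1" if "x \<in> K" for x n
  proof -
    obtain y where y: "y \<in> F" "\<forall>n. norm (x n - y n) \<le> 1"
      using F(3) \<open>x \<in> K\<close> by blast
    then have "norm (x n - y n) \<le> 1" by blast
    with B[OF y(1), of n] show ?thesis
      using norm_triangle_sub[of "x n" "y n"] by linarith
  qed
  then show ?thesis by blast
qed

lemma norm_le_a_seq:
  assumes "\<forall>x\<in>K. \<forall>n. norm (x n) \<le> B" "x \<in> K"
  shows "norm (x n) \<le> a_seq K n"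
  unfolding a_seq_def by (rule le_nnsup[of _ _ B]) (use assms in auto)

lemma a_seq_nonneg:
  assumes "\<forall>x\<in>K. \<forall>n. norm (x n) \<le> B"
  shows "0 \<le> a_seq K n"
proof (cases "K = {}")
  case True
  then show ?thesis by (simp add: a_seq_def nnsup_def)
next
  case False
  then obtain x where "x \<in> K" by blast
  then show ?thesis
    using norm_le_a_seq[OF assms] norm_ge_zero order_trans by blast
qed

lemma a_seq_le:
  assumes "\<And>x. x \<in> K \<Longrightarrow> norm (x n) \<le> B" "0 \<le> B"
  shows "a_seq K n \<le> B"
  unfolding a_seq_def by (rule nnsup_le) (use assms in auto)

lemma omega_ideal_UN:
  assumes "omega_ideal I" "finite F" "\<And>y. y \<in> F \<Longrightarrow> S y \<in> I"
  shows "(\<Union>y\<in>F. S y) \<in> I"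
  using assms(2,3,1)
  by (induction F) (auto simp: omega_ideal_def)

text \<open>Where all members of an \<open>\<epsilon>/3\<close>-net are below
  \<open>\<epsilon>/3\<close>, \<open>a_seq K\<close> is at most \<open>2*\<epsilon>/3\<close>.
  Hence its large set is covered by the large sets of finitely many elements of
  \<open>c0_ideal I\<close>.\<close>

lemma a_seq_in_c0_ideal:
  assumes I: "omega_ideal I" and sub: "K \<subseteq> mspace (c0_ideal I)" and nets: "finite_uniform_nets UNIV K"
  shows "a_seq K \<in> mspace (c0_ideal I)"
proof -
  have "bounded (range x)" if "x \<in> K" for x
    using sub that by (auto simp: mspace_c0_ideal)
  then obtain B where B: "\<forall>x\<in>K. \<forall>n. norm (x n) \<le> B"
    using finite_uniform_nets_imp_bounded[OF nets] by blast
  have "norm (a_seq K n) \<le> max 0 B" for n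
    using a_seq_nonneg[OF B, of n] a_seq_le[of K n "max 0 B"] B by (simp add: le_max_iff_disj)
  then have "bounded (range (a_seq K))"
    by (auto simp: bounded_iff)
  moreover have "{n. \<epsilon> \<le> norm (a_seq K n)} \<in> I" if "\<epsilon> > 0" for \<epsilon>
  proof -
    have "\<epsilon>/3 > 0" using that by simp
    then obtain F where F: "finite F" "F \<subseteq> K" "\<And>x. x \<in> K \<Longrightarrow> \<exists>y\<in>F. \<forall>n. norm (x n - y n) \<le> \<epsilon>/3"
      using nets unfolding finite_uniform_nets_def by (metis UNIV_I)
    have "{n. \<epsilon> \<le> norm (a_seq K n)} \<subseteq> (\<Union>y\<in>F. {n. \<epsilon>/3 \<le> norm (y n)})"
    proof (rule ccontr)
      assume "\<not> ?thesis"
      then obtain n where "\<epsilon> \<le> norm (a_seq K n)" "n \<notin> (\<Union>y\<in>F. {n. \<epsilon>/3 \<le> norm (y n)})"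
        by blast
      then have n: "\<epsilon> \<le> a_seq K n" "\<And>y. y \<in> F \<Longrightarrow> norm (y n) < \<epsilon>/3"
        using a_seq_nonneg[OF B, of n] by auto
      \<comment> \<open>The gap between \<open>2*\<epsilon>/3\<close> and \<open>\<epsilon>\<close>
        survives passing to the supremum over \<open>K\<close>, which a mere strict bound by
        \<open>\<epsilon>\<close> would not.\<close>
      have "norm (x n) \<le> 2*\<epsilon>/3" if "x \<in> K" for x
      proof -
        obtain y where y: "y \<in> F" "\<forall>n. norm (x n - y n) \<le> \<epsilon>/3"
          using F(3) \<open>x \<in> K\<close> by blast
        then have "norm (x n - y n) \<le> \<epsilon>/3" by blast
        with n(2)[OF y(1)] show ?thesis
          using norm_triangle_sub[of "x n" "y n"] by linarith
      qed
      then have "a_seq K n \<le> 2*\<epsilon>/3"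
        by (rule a_seq_le) (use that in auto)
      with n(1) that show False by simp
    qed
    moreover have "{n. \<epsilon>/3 \<le> norm (y n)} \<in> I" if "y \<in> F" for y
      using F(2) sub \<open>\<epsilon>/3 > 0\<close> that unfolding mspace_c0_ideal by blast
    then have "(\<Union>y\<in>F. {n. \<epsilon>/3 \<le> norm (y n)}) \<in> I"
      by (rule omega_ideal_UN[OF I F(1)])
    ultimately show ?thesis
      using I unfolding omega_ideal_def by blast
  qed
  ultimately show ?thesis
    by (simp add: mspace_c0_ideal)
qed

section \<open>The cycle of implications\<close>

theorem theorem4p5:
  fixes I :: "nat set set"
    and K :: "(nat \<Rightarrow> 'a::{real_normed_field,heine_borel}) set"
  assumes "omega_ideal I"
    and "K \<subseteq> mspace (c0_ideal I)"
    and "K \<noteq> {}"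
  shows
    "(relatively_compact_in (c0_ideal I) K \<longleftrightarrow>
        bounded_in (linf UNIV) K \<and>
        a_seq K \<in> mspace (c0_ideal I) \<and>
        (\<forall>A\<in>I. relatively_compact_in (linf A) (proj_set A K))) \<and>
     (relatively_compact_in (c0_ideal I) K \<longleftrightarrow>
        (\<exists>b\<in>c0_ideal_pos I.
           (\<forall>x\<in>K. \<forall>n. norm (x n) \<le> b n) \<and>
           (\<forall>t>0. relatively_compact_in (linf {n. b n \<ge> t}) (proj_set {n. b n \<ge> t} K)))) \<and>
     (relatively_compact_in (c0_ideal I) K \<longleftrightarrow>
        bounded_in (linf UNIV) K \<and>
        (\<forall>\<epsilon>>0. \<exists>A\<in>I. \<exists>m. \<exists>P :: nat \<Rightarrow> nat set.
           A = (\<Union>j\<in>{1..m}. P j) \<and> disjoint_family_on P {1..m} \<and>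
           nnsup {nnsup {norm (x n) | n. n \<notin> A} | x. x \<in> K} < \<epsilon> \<and>
           (\<forall>j\<in>{1..m}.
              nnsup {nnsup {norm (x n - x k) | n k. n \<in> P j \<and> k \<in> P j} | x. x \<in> K} < \<epsilon>)))"
proof -
  \<comment> \<open>Naming conditions (2) to (4) allows the three equivalences with (1) to be read
    off from the cycle (1), (2), (3), (4), (1).\<close>
  define C2 where "C2 \<longleftrightarrow> bounded_in (linf UNIV) K \<and> a_seq K \<in> mspace (c0_ideal I) \<and>
        (\<forall>A\<in>I. relatively_compact_in (linf A) (proj_set A K))"
  define C3 where "C3 \<longleftrightarrow> (\<exists>b\<in>c0_ideal_pos I.
           (\<forall>x\<in>K. \<forall>n. norm (x n) \<le> b n) \<and>
           (\<forall>t>0. relatively_compact_in (linf {n. b n \<ge> t}) (proj_set {n. b n \<ge> t} K)))"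
  define C4 where "C4 \<longleftrightarrow> bounded_in (linf UNIV) K \<and>
        (\<forall>\<epsilon>>0. \<exists>A\<in>I. \<exists>m. \<exists>P :: nat \<Rightarrow> nat set.
           A = (\<Union>j\<in>{1..m}. P j) \<and> disjoint_family_on P {1..m} \<and>
           nnsup {nnsup {norm (x n) | n. n \<notin> A} | x. x \<in> K} < \<epsilon> \<and>
           (\<forall>j\<in>{1..m}.
              nnsup {nnsup {norm (x n - x k) | n k. n \<in> P j \<and> k \<in> P j} | x. x \<in> K} < \<epsilon>))"
  have bdd: "bounded (range x)" if "x \<in> K" for x
    using assms(2) that by (auto simp: mspace_c0_ideal)
  have bdd': "bounded (x ` A)" if "x \<in> K" for x A
    using bdd[OF that] by (rule bounded_subset) auto
  have bd_iff: "bounded_in (linf UNIV) K \<longleftrightarrow> (\<exists>B. \<forall>x\<in>K. \<forall>n. norm (x n) \<le> B)"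
    using bdd by (intro bounded_in_linf_iff) (auto simp: mspace_linf)
  have rc_iff: "relatively_compact_in (linf A) (proj_set A K) \<longleftrightarrow> finite_uniform_nets A K" for A
    using bdd' by (rule relatively_compact_in_linf_iff)
  have rc0_iff: "relatively_compact_in (c0_ideal I) K \<longleftrightarrow> finite_uniform_nets UNIV K"
    using assms by (intro relatively_compact_in_c0_ideal_iff)
  have 12: C2 if "relatively_compact_in (c0_ideal I) K"
  proof -
    have nets: "finite_uniform_nets UNIV K"
      using that rc0_iff by blast
    then show ?thesis
      unfolding C2_def bd_iff rc_iff
      using finite_uniform_nets_imp_bounded[OF nets bdd] a_seq_in_c0_ideal[OF assms(1,2) nets]
        finite_uniform_nets_subset by blast
  qed
  have 23: C3 if C2
  proof -
    from that obtain B where B: "\<forall>x\<in>K. \<forall>n. norm (x n) \<le> B"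
      unfolding C2_def bd_iff by blast
    have a: "0 \<le> a_seq K n" for n
      using B by (rule a_seq_nonneg)
    \<comment> \<open>With \<open>b = a_seq K\<close> the sets in condition (3) belong to the ideal,
      so condition (2) applies to each of them.\<close>
    have "{n. t \<le> a_seq K n} \<in> I" if "t > 0" for t
      using \<open>C2\<close> that a by (simp add: C2_def mspace_c0_ideal)
    with \<open>C2\<close> a show ?thesis
      unfolding C3_def C2_def c0_ideal_pos_def using norm_le_a_seq[OF B] by blast
  qed
  have 34: C4 if C3
  proof -
    obtain b where b_pos: "b \<in> c0_ideal_pos I"
      and b: "\<forall>x\<in>K. \<forall>n. norm (x n) \<le> b n" "\<forall>t>0. finite_uniform_nets {n. t \<le> b n} K"
      using \<open>C3\<close> unfolding C3_def rc_iff by blast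
    have b0: "b \<in> mspace (c0_ideal I)" "\<And>n. 0 \<le> b n"
      using b_pos by (auto simp: c0_ideal_pos_def)
    obtain B where "\<And>n. norm (b n) \<le> B"
      using b0(1) by (auto simp: mspace_c0_ideal bounded_iff)
    then have "\<forall>x\<in>K. \<forall>n. norm (x n) \<le> B"
      using b(1) b0(2) by (metis abs_of_nonneg order_trans real_norm_def)
    moreover have "\<exists>A\<in>I. \<exists>m. \<exists>P :: nat \<Rightarrow> nat set.
           A = (\<Union>j\<in>{1..m}. P j) \<and> disjoint_family_on P {1..m} \<and>
           nnsup {nnsup {norm (x n) | n. n \<notin> A} | x. x \<in> K} < \<epsilon> \<and>
           (\<forall>j\<in>{1..m}.
              nnsup {nnsup {norm (x n - x k) | n k. n \<in> P j \<and> k \<in> P j} | x. x \<in> K} < \<epsilon>)"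
      if "\<epsilon> > 0" for \<epsilon>
    proof -
      \<comment> \<open>The threshold \<open>\<epsilon>/2\<close> leaves room for the suprema, which
        preserve only non-strict bounds, to stay strictly below \<open>\<epsilon>\<close>.\<close>
      define A where "A = {n. \<epsilon>/2 \<le> b n}"
      have e: "\<epsilon>/2 > 0" "\<epsilon>/2 < \<epsilon>" using that by auto
      have "A \<in> I"
        using b0(1) e(1) abs_of_nonneg[OF b0(2)] unfolding A_def mspace_c0_ideal by (metis (mono_tags, lifting) Collect_cong mem_Collect_eq real_norm_def)
      have "finite_uniform_nets A K"
        unfolding A_def using e(1) b(2) by blast
      then obtain m and P :: "nat \<Rightarrow> nat set" where
        P: "A = (\<Union>j\<in>{1..m}. P j)" "disjoint_family_on P {1..m}"
        "\<And>j x n k. \<lbrakk>j \<in> {1..m}; x \<in> K; n \<in> P j; k \<in> P j\<rbrakk> \<Longrightarrow> norm (x n - x k) \<le> \<epsilon>/2"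
        using finite_uniform_nets_partition[OF _ bdd' e(1)] by blast
      have "norm (x n) \<le> \<epsilon>/2" if "x \<in> K" "n \<notin> A" for x n
      proof -
        have "b n < \<epsilon>/2" using that(2) by (auto simp: A_def)
        with b(1) that(1) show ?thesis by (metis less_imp_le order_trans)
      qed
      then have "nnsup {nnsup {norm (x n) | n. n \<notin> A} | x. x \<in> K} \<le> \<epsilon>/2"
        by (intro nnsup_nnsup_le) (use e(1) in auto)
      moreover have "nnsup {nnsup {norm (x n - x k) | n k. n \<in> P j \<and> k \<in> P j} | x. x \<in> K} \<le> \<epsilon>/2"
        if "j \<in> {1..m}" for j
        by (intro nnsup_nnsup_le) (use e(1) P(3)[OF that] in auto)
      ultimately show ?thesis
        by (intro bexI[OF _ \<open>A \<in> I\<close>] exI[of _ m] exI[of _ P] conjI ballI P(1,2))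
          (use e(2) in \<open>blast intro: le_less_trans\<close>)+
    qed
    ultimately show ?thesis
      unfolding C4_def bd_iff by blast
  qed
  have 41: "relatively_compact_in (c0_ideal I) K" if C4
  proof -
    obtain B where B: "\<And>x n. x \<in> K \<Longrightarrow> norm (x n) \<le> B"
      using \<open>C4\<close> unfolding C4_def bd_iff by blast
    \<comment> \<open>Bounds the oscillation sets from above, so that their suprema in condition (4)
      dominate the individual differences.\<close>
    have B2: "norm (x n - x k) \<le> B + B" if "x \<in> K" for x n k
      using B[OF that, of n] B[OF that, of k] norm_triangle_ineq4[of "x n" "x k"] by linarith
    obtain x0 where "x0 \<in> K" using assms(3) by blast
    \<comment> \<open>Nonemptiness of \<open>K\<close> enters here; the sign of \<open>B\<close>
      handles inner suprema over empty sets, such as those with \<open>A\<close> equal to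
      \<open>UNIV\<close>.\<close>
    have "0 \<le> B" using B[OF \<open>x0 \<in> K\<close>, of 0] norm_ge_zero order_trans by blast
    have "\<exists>m. \<exists>P :: nat \<Rightarrow> nat set.
      (\<forall>x\<in>K. (\<forall>n. n \<notin> (\<Union>j\<in>{1..m}. P j) \<longrightarrow> norm (x n) \<le> \<epsilon>) \<and>
        (\<forall>j\<in>{1..m}. \<forall>n\<in>P j. \<forall>k\<in>P j. norm (x n - x k) \<le> \<epsilon>))" if "\<epsilon> > 0" for \<epsilon>
    proof -
      obtain A m and P :: "nat \<Rightarrow> nat set" where A: "A = (\<Union>j\<in>{1..m}. P j)"
        and out: "nnsup {nnsup {norm (x n) | n. n \<notin> A} | x. x \<in> K} < \<epsilon>"
        and osc: "\<And>j. j \<in> {1..m} \<Longrightarrow>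
          nnsup {nnsup {norm (x n - x k) | n k. n \<in> P j \<and> k \<in> P j} | x. x \<in> K} < \<epsilon>"
        using \<open>C4\<close> \<open>\<epsilon> > 0\<close> unfolding C4_def by meson
      have "norm (x n) \<le> \<epsilon>" if "x \<in> K" "n \<notin> A" for x n
      proof -
        have "norm (x n) \<le> nnsup {nnsup {norm (x n) | n. n \<notin> A} | x. x \<in> K}"
          by (rule le_nnsup_nnsup[where B=B]) (use that B \<open>0 \<le> B\<close> in auto)
        then show ?thesis using out by simp
      qed
      moreover have "norm (x n - x k) \<le> \<epsilon>" if "x \<in> K" "j \<in> {1..m}" "n \<in> P j" "k \<in> P j" for x j n k
      proof -
        have "norm (x n - x k) \<le> nnsup {nnsup {norm (x n - x k) | n k. n \<in> P j \<and> k \<in> P j} | x. x \<in> K}"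
          by (rule le_nnsup_nnsup[where B="B + B"]) (use that B2 \<open>0 \<le> B\<close> in auto)
        then show ?thesis using osc[OF that(2)] by simp
      qed
      ultimately show ?thesis
        unfolding A by (intro exI[of _ m] exI[of _ P]) blast
    qed
    then show ?thesis
      unfolding rc0_iff using finite_uniform_nets_UNIV_if_partitions[of K B] B by blast
  qed
  show ?thesis
    using 12 23 34 41 unfolding C2_def C3_def C4_def by argo
qed

end
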